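(* Let $Q\in\mathrm{Gr}(k,n)$ with $Q=VI_{k,n-k}V^{\mathsf T}$, $V\in\mathrm{O}(n)$, and let \[ \operatorname{proj}^{\mathbb{T}}_Q:\mathbb{T}_Q\mathrm{O}(n)\to\mathbb{T}_Q\mathrm{Gr}(k,n),\qquad \operatorname{proj}^{\mathbb{N}}_Q:\mathbb{T}_Q\mathrm{O}(n)\to\mathbb{N}_Q\mathrm{Gr}(k,n) \] be the orthogonal projections onto the tangent and normal spaces of $\mathrm{Gr}(k,n)$ at $Q$. Then for every skew-symmetric $\Lambda\in\mathbb{R}^{n\times n}$, \[ \operatorname{proj}^{\mathbb{T}}_Q(Q\Lambda)=\tfrac12(Q\Lambda-\Lambda Q)=\tfrac12V(S+S^{\mathsf T})V^{\mathsf T},\qquad \operatorname{proj}^{\mathbb{N}}_Q(Q\Lambda)=\tfrac12(Q\Lambda+\Lambda Q)=\tfrac12V(S-S^{\mathsf T})V^{\mathsf T}, \] for any decomposition $Q\Lambda=VSV^{\mathsf T}$ where $S\in\mathbb{R}^{n\times n}$ is such that $I_{k,n-k}S$ is skew-symmetric.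
   Context: For $k\in\{1,\dots,n\}$, $\mathrm{Gr}(k,n)=\{Q\in\mathrm{O}(n):Q^{\mathsf T}=Q,\ \operatorname{tr}(Q)=2k-n\}$, an embedded submanifold of $\mathrm{O}(n)$; $I_{k,n-k}=\operatorname{diag}(I_k,-I_{n-k})$; every $Q\in\mathrm{Gr}(k,n)$ can be written $Q=VI_{k,n-k}V^{\mathsf T}$ with $V\in\mathrm{O}(n)$. $\mathbb{T}_Q\mathrm{O}(n)=\{Q\Lambda:\Lambda^{\mathsf T}=-\Lambda\}$ carries the inner product $\operatorname{tr}(X^{\mathsf T}Y)$, and the normal space $\mathbb{N}_Q\mathrm{Gr}(k,n)$ is the orthogonal complement of the tangent space $\mathbb{T}_Q\mathrm{Gr}(k,n)$ in $\mathbb{T}_Q\mathrm{O}(n)$. *)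

theory Defs
  imports "HOL-Analysis.Analysis"
begin

definition skew_symmetric :: "real^'n^'n \<Rightarrow> bool" where
  "skew_symmetric A \<longleftrightarrow> transpose A = - A"

text \<open>The order on the index type is used only to say which diagonal entries come first:
  index \<open>i\<close> is among the first \<open>k\<close> iff fewer than \<open>k\<close> indices precede it.\<close>

definition signature_matrix :: "nat \<Rightarrow> real^('n::{finite,linorder})^('n::{finite,linorder})" where
  "signature_matrix k =
     (\<chi> i j. if i = j then (if card {..<i} < k then 1 else - 1) else 0)"

definition Grassmannian :: "nat \<Rightarrow> (real^'n^'n) set" where
  "Grassmannian k =
     {Q. orthogonal_matrix Q \<and> transpose Q = Q \<and> trace Q = 2 * real k - real CARD('n)}"

definition smooth_curve_on :: "real set \<Rightarrow> (real \<Rightarrow> 'a::real_normed_vector) \<Rightarrow> bool" where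
  "smooth_curve_on I c \<longleftrightarrow>
     (\<exists>D. D 0 = c \<and> (\<forall>m. \<forall>t\<in>I. (D m has_vector_derivative D (Suc m) t) (at t)))"

text \<open>For an embedded submanifold \<open>M\<close> of a normed space, the tangent space at a point consists of
  the velocities of the smooth curves in \<open>M\<close> through that point.\<close>

definition tangent_space :: "'a::real_normed_vector set \<Rightarrow> 'a \<Rightarrow> 'a set" where
  "tangent_space M x =
     {v. \<exists>e>0. \<exists>c. smooth_curve_on {-e<..<e} c \<and> c ` {-e<..<e} \<subseteq> M \<and> c 0 = x \<and>
                   (c has_vector_derivative v) (at 0)}"

definition orthogonal_tangent_space :: "real^'n^'n \<Rightarrow> (real^'n^'n) set" where
  "orthogonal_tangent_space Q = {Q ** \<Lambda> | \<Lambda>. skew_symmetric \<Lambda>}"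

definition trace_inner :: "real^'n^'n \<Rightarrow> real^'n^'n \<Rightarrow> real" where
  "trace_inner X Y = trace (transpose X ** Y)"

definition Grassmannian_normal_space :: "nat \<Rightarrow> real^'n^'n \<Rightarrow> (real^'n^'n) set" where
  "Grassmannian_normal_space k Q =
     {X \<in> orthogonal_tangent_space Q. \<forall>Y \<in> tangent_space (Grassmannian k) Q. trace_inner X Y = 0}"

text \<open>Orthogonal projection onto a linear subspace \<open>W\<close>; its value is meaningful only where
  the projected point exists and is unique.\<close>

definition orth_proj :: "(real^'n^'n) set \<Rightarrow> real^'n^'n \<Rightarrow> real^'n^'n" where
  "orth_proj W X = (THE Y. Y \<in> W \<and> (\<forall>Z\<in>W. trace_inner (X - Y) Z = 0))"

definition proj_tangent :: "nat \<Rightarrow> real^'n^'n \<Rightarrow> real^'n^'n \<Rightarrow> real^'n^'n" where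
  "proj_tangent k Q = orth_proj (tangent_space (Grassmannian k) Q)"

definition proj_normal :: "nat \<Rightarrow> real^'n^'n \<Rightarrow> real^'n^'n \<Rightarrow> real^'n^'n" where
  "proj_normal k Q = orth_proj (Grassmannian_normal_space k Q)"

end

theory Submission imports Defs begin

text \<open>
  The tangent space at \<open>Q\<close> is the space of symmetric matrices anticommuting with \<open>Q\<close>.
  Velocities satisfy these equations because \<open>c(t)\<^sup>T = c(t)\<close> and \<open>c(t)\<^sup>2 = I\<close> along a curve \<open>c\<close> in
  the Grassmannian. Conversely, for such an \<open>X\<close> the matrix \<open>A = XQ/2\<close> is skew-symmetric and
  \<open>AQ - QA = X\<close>; conjugating \<open>Q\<close> by the orthogonal matrices \<open>exp(tA)\<close> gives a curve in the
  Grassmannian with velocity \<open>X\<close>. It is smooth because it solves the linear equation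
  \<open>c' = Ac - cA\<close>, so that its derivatives are the iterates of this linear map applied to \<open>c\<close>.

  In \<open>Q\<Lambda> = (Q\<Lambda> - \<Lambda>Q)/2 + (Q\<Lambda> + \<Lambda>Q)/2\<close> the first term lies in this space, and the second is
  skew-symmetric, hence orthogonal to all symmetric matrices. The formulas in \<open>S\<close> follow from
  \<open>(Q\<Lambda>)\<^sup>T = - \<Lambda>Q\<close>.
\<close>

section \<open>Linear differential equations with constant coefficients\<close>

text \<open>The solution is the exponential series, the sum of t^m/m! times
  \<open>(L ^^ m) x\<close>. It is built coordinate by coordinate, so that termwise differentiation
  of real power series applies.\<close>

lemma exists_linear_ode_solution:
  fixes L :: "'a::euclidean_space \<Rightarrow> 'a"
  assumes "linear L"
  shows "\<exists>e. e 0 = x \<and> (\<forall>t. (e has_vector_derivative L (e t)) (at t))"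
proof -
  interpret L: linear L by fact
  obtain K where K: "K > 0" "\<And>v. norm (L v) \<le> norm v * K"
    using bounded_linear.pos_bounded[OF linear_conv_bounded_linear[THEN iffD1, OF assms]] by blast
  \<comment> \<open>Geometric growth of the iterates lets a scalar exponential series dominate every
    coordinate series.\<close>
  have pow: "norm ((L ^^ m) x) \<le> norm x * K ^ m" for m
  proof (induction m)
    case (Suc m)
    have "norm ((L ^^ Suc m) x) \<le> norm ((L ^^ m) x) * K" using K(2) by simp
    also have "\<dots> \<le> norm x * K ^ m * K" using Suc K(1) by (simp add: mult_right_mono)
    finally show ?case by (simp add: mult_ac)
  qed simp
  define a where "a b m = ((L ^^ m) x \<bullet> b) / fact m" for b m
  have summ: "summable (\<lambda>m. a b m * t ^ m)" for b t
  proof (rule summable_comparison_test')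
    show "summable (\<lambda>m. norm x * norm b * (inverse (fact m) * (K * \<bar>t\<bar>) ^ m))"
      by (intro summable_mult summable_exp)
    fix m :: nat
    have "\<bar>(L ^^ m) x \<bullet> b\<bar> \<le> norm x * K ^ m * norm b"
      using Cauchy_Schwarz_ineq2[of "(L ^^ m) x" b] mult_right_mono[OF pow[of m], of "norm b"] by simp
    then have "\<bar>(L ^^ m) x \<bullet> b\<bar> * \<bar>t\<bar> ^ m / fact m \<le> norm x * K ^ m * norm b * \<bar>t\<bar> ^ m / fact m"
      by (intro divide_right_mono mult_right_mono) auto
    then show "norm (a b m * t ^ m) \<le> norm x * norm b * (inverse (fact m) * (K * \<bar>t\<bar>) ^ m)"
      by (simp add: a_def abs_mult power_abs power_mult_distrib field_simps)
  qed
  define e where "e t = (\<Sum>b\<in>Basis. (\<Sum>m. a b m * t ^ m) *\<^sub>R b)" for t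
  have e_inner: "e t \<bullet> b = (\<Sum>m. a b m * t ^ m)" if "b \<in> Basis" for t b
    using that by (simp add: e_def)
  \<comment> \<open>The differential equation at the level of coefficients: differentiating a
    coordinate series shifts the iterate by one \<open>L\<close>, and expanding in the basis turns
    this \<open>L\<close> into a finite combination of the coordinate series.\<close>
  have diffs: "diffs (a b) m = (\<Sum>j\<in>Basis. a j m * (L j \<bullet> b))" for b m
  proof -
    have "diffs (a b) m = (L ((L ^^ m) x) \<bullet> b) / fact m"
      by (simp add: diffs_def a_def divide_simps)
    also have "(L ^^ m) x = (\<Sum>j\<in>Basis. ((L ^^ m) x \<bullet> j) *\<^sub>R j)"
      by (simp add: euclidean_representation)
    then have "L ((L ^^ m) x) = (\<Sum>j\<in>Basis. ((L ^^ m) x \<bullet> j) *\<^sub>R L j)"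
      by (metis (no_types, lifting) L.sum L.scale sum.cong)
    then have "(L ((L ^^ m) x) \<bullet> b) / fact m = (\<Sum>j\<in>Basis. a j m * (L j \<bullet> b))"
      by (simp add: inner_sum_left sum_divide_distrib a_def)
    finally show ?thesis .
  qed
  have L_inner: "L (e t) \<bullet> b = (\<Sum>m. diffs (a b) m * t ^ m)" for t b
  proof -
    have "L (e t) \<bullet> b = (\<Sum>j\<in>Basis. (\<Sum>m. a j m * t ^ m) * (L j \<bullet> b))"
      by (simp add: e_def L.sum L.scale inner_sum_left)
    also have "\<dots> = (\<Sum>j\<in>Basis. (\<Sum>m. a j m * t ^ m * (L j \<bullet> b)))"
      by (simp add: suminf_mult2[OF summ])
    also have "\<dots> = (\<Sum>m. \<Sum>j\<in>Basis. a j m * t ^ m * (L j \<bullet> b))"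
      by (rule suminf_sum[symmetric]) (intro summable_mult2 summ)
    finally show ?thesis by (simp add: diffs sum_distrib_left mult_ac)
  qed
  have "(e has_vector_derivative L (e t)) (at t)" for t
    unfolding has_vector_derivative_def
  proof (subst has_derivative_componentwise_within, intro ballI)
    fix b :: 'a assume b: "b \<in> Basis"
    have "((\<lambda>t. \<Sum>m. a b m * t ^ m) has_field_derivative (\<Sum>m. diffs (a b) m * t ^ m)) (at t)"
      by (rule termdiffs_strong_converges_everywhere) (rule summ)
    then show "((\<lambda>t. e t \<bullet> b) has_derivative (\<lambda>h. h *\<^sub>R L (e t) \<bullet> b)) (at t)"
      by (simp add: e_inner[OF b] L_inner has_field_derivative_def mult_commute_abs)
  qed
  moreover have "e 0 = x"
  proof (rule euclidean_eqI)
    fix b :: 'a assume "b \<in> Basis"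
    then show "e 0 \<bullet> b = x \<bullet> b"
      by (simp add: e_inner powser_zero) (simp add: a_def)
  qed
  ultimately show ?thesis by blast
qed

section \<open>Matrix calculus and the trace inner product\<close>

text \<open>Boundedness supplies the product rule for matrix-valued curves as well as the
  distributive laws collected below.\<close>

lemma bounded_bilinear_matrix_mult:
  "bounded_bilinear ((**) :: real^'n^'m \<Rightarrow> real^'p^'n \<Rightarrow> real^'p^'m)"
  unfolding bilinear_conv_bounded_bilinear[symmetric] bilinear_def
  by (intro conjI allI linearI)
    (simp_all add: vec_eq_iff matrix_matrix_mult_def sum.distrib ring_distribs
      sum_distrib_left mult_ac)

lemmas matrix_mult_distribs =
  bounded_bilinear.add_left[OF bounded_bilinear_matrix_mult]
  bounded_bilinear.add_right[OF bounded_bilinear_matrix_mult]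
  bounded_bilinear.diff_left[OF bounded_bilinear_matrix_mult]
  bounded_bilinear.diff_right[OF bounded_bilinear_matrix_mult]
  bounded_bilinear.minus_left[OF bounded_bilinear_matrix_mult]
  bounded_bilinear.minus_right[OF bounded_bilinear_matrix_mult]
  bounded_bilinear.scaleR_left[OF bounded_bilinear_matrix_mult]
  bounded_bilinear.scaleR_right[OF bounded_bilinear_matrix_mult]

lemma bounded_linear_transpose: "bounded_linear (transpose :: real^'n^'m \<Rightarrow> real^'m^'n)"
  unfolding linear_conv_bounded_linear[symmetric]
  by (intro linearI) (simp_all add: transpose_def vec_eq_iff)

lemmas transpose_distribs =
  linear_add[OF bounded_linear.linear[OF bounded_linear_transpose]]
  linear_diff[OF bounded_linear.linear[OF bounded_linear_transpose]]
  linear_neg[OF bounded_linear.linear[OF bounded_linear_transpose]]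
  transpose_scalar

lemma trace_inner_eq_inner: "trace_inner X Y = X \<bullet> Y"
proof -
  have "trace_inner X Y = (\<Sum>j\<in>UNIV. \<Sum>i\<in>UNIV. X$i$j * Y$i$j)"
    by (simp add: trace_inner_def trace_def matrix_matrix_mult_def transpose_def)
  also have "\<dots> = X \<bullet> Y"
    by (subst sum.swap) (simp add: inner_vec_def)
  finally show ?thesis .
qed

text \<open>Since \<open>orth_proj\<close> is a definite description, uniqueness is the point: the
  difference of two candidates lies in \<open>W\<close> and is orthogonal to itself.\<close>

lemma orth_proj_eqI:
  assumes "subspace W" "Y \<in> W" and orth: "\<And>Z. Z \<in> W \<Longrightarrow> trace_inner (X - Y) Z = 0"
  shows "orth_proj W X = Y"
  unfolding orth_proj_def
proof (rule the_equality)
  fix Y' assume Y': "Y' \<in> W \<and> (\<forall>Z\<in>W. trace_inner (X - Y') Z = 0)"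
  have "Y' - Y \<in> W" using Y' assms subspace_diff by blast
  then have "(X - Y) \<bullet> (Y' - Y) = 0" "(X - Y') \<bullet> (Y' - Y) = 0"
    using orth Y' by (auto simp: trace_inner_eq_inner)
  then have "(Y' - Y) \<bullet> (Y' - Y) = 0" by (simp add: inner_diff_left)
  then show "Y' = Y" by simp
qed (use assms in blast)

text \<open>Transposition preserves the inner product, negates \<open>X\<close> and fixes
  \<open>Y\<close>.\<close>

lemma inner_skew_symmetric_symmetric:
  fixes X Y :: "real^'n^'n"
  assumes "skew_symmetric X" "transpose Y = Y"
  shows "X \<bullet> Y = 0"
proof -
  have "X \<bullet> Y = transpose X \<bullet> transpose Y"
    unfolding inner_vec_def by (simp add: transpose_def) (rule sum.swap)
  also have "\<dots> = - (X \<bullet> Y)"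
    using assms by (simp add: skew_symmetric_def)
  finally show ?thesis by simp
qed

section \<open>The tangent space of the Grassmannian\<close>

lemma GrassmannianD:
  assumes "Q \<in> Grassmannian k"
  shows "transpose Q = Q" "Q ** Q = mat 1"
  using assms by (auto simp: Grassmannian_def orthogonal_matrix)

lemma Grassmannian_conjugate:
  assumes "Q \<in> Grassmannian k" "orthogonal_matrix U"
  shows "U ** Q ** transpose U \<in> Grassmannian k"
proof -
  have "trace (U ** Q ** transpose U) = trace (transpose U ** (U ** Q))"
    by (rule trace_mul_sym)
  also have "\<dots> = trace Q"
    using assms(2) by (simp add: matrix_mul_assoc orthogonal_matrix)
  finally show ?thesis
    using assms
    by (auto simp: Grassmannian_def matrix_transpose_mul matrix_mul_assoc
        intro!: orthogonal_matrix_mul)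
qed

lemma tangent_vector_equations:
  assumes "X \<in> tangent_space (Grassmannian k) Q"
  shows "transpose X = X \<and> X ** Q + Q ** X = 0"
proof -
  obtain e c where e: "e > 0" and c: "c ` {-e<..<e} \<subseteq> Grassmannian k" "c 0 = Q"
      and d: "(c has_vector_derivative X) (at 0)"
    using assms by (auto simp: tangent_space_def)
  have cM: "transpose (c t) = c t" "c t ** c t = mat 1" if "t \<in> {-e<..<e}" for t
    using GrassmannianD[of "c t" k] c(1) that by blast+
  \<comment> \<open>The defining identities hold along \<open>c\<close> only near 0, so they are
    differentiated through local agreement of the two sides.\<close>
  have unique: "v = w"
    if "(f has_vector_derivative v) (at 0)" "(g has_vector_derivative w) (at 0)"
      "\<And>t. t \<in> {-e<..<e} \<Longrightarrow> f t = g t"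
    for f g :: "real \<Rightarrow> real^'a^'a" and v w
  proof -
    have "(g has_vector_derivative v) (at 0)"
      by (rule has_vector_derivative_transform_within_open[OF that(1), of "{-e<..<e}"])
        (use e that(3) in auto)
    then show ?thesis using that(2) vector_derivative_unique_at by blast
  qed
  have "transpose X = X"
    by (rule unique[OF bounded_linear.has_vector_derivative[OF bounded_linear_transpose d] d])
      (rule cM)
  moreover have "c 0 ** X + X ** c 0 = 0"
    by (rule unique[OF bounded_bilinear.has_vector_derivative[OF bounded_bilinear_matrix_mult d d]
          has_vector_derivative_const]) (rule cM)
  ultimately show ?thesis using c(2) by (simp add: add.commute)
qed

text \<open>Here E(t) = exp(tA). The derivative of E^T E is E^T (A + A^T) E, which vanishes for
  skew-symmetric A, so E^T E keeps its initial value.\<close>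

lemma exists_orthogonal_flow:
  fixes A :: "real^'n^'n"
  assumes "skew_symmetric A"
  shows "\<exists>E. E 0 = mat 1 \<and> (\<forall>t. orthogonal_matrix (E t)) \<and>
             (\<forall>t. (E has_vector_derivative A ** E t) (at t))"
proof -
  have "linear (\<lambda>X. A ** X)"
    by (intro linearI) (simp_all add: matrix_mult_distribs)
  from exists_linear_ode_solution[OF this, of "mat 1"]
  obtain E where E: "E 0 = mat 1" "\<And>t. (E has_vector_derivative A ** E t) (at t)"
    by blast
  have "((\<lambda>t. transpose (E t) ** E t) has_vector_derivative 0) (at t)" for t
  proof (rule has_vector_derivative_eq_rhs)
    show "((\<lambda>t. transpose (E t) ** E t) has_vector_derivative
        transpose (E t) ** (A ** E t) + transpose (A ** E t) ** E t) (at t)"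
      by (intro bounded_bilinear.has_vector_derivative[OF bounded_bilinear_matrix_mult]
          bounded_linear.has_vector_derivative[OF bounded_linear_transpose] E(2))
  qed (use assms in \<open>simp add: skew_symmetric_def matrix_transpose_mul matrix_mult_distribs
      matrix_mul_assoc\<close>)
  then obtain C where C: "\<And>t. transpose (E t) ** E t = C"
    using has_vector_derivative_zero_constant[of UNIV "\<lambda>t. transpose (E t) ** E t"] by auto
  have "C = mat 1" using C[of 0] E(1) by simp
  then show ?thesis using E C by (auto simp: orthogonal_matrix)
qed

lemma tangent_space_Grassmannian:
  assumes Q: "Q \<in> Grassmannian k"
  shows "tangent_space (Grassmannian k) Q = {X. transpose X = X \<and> X ** Q + Q ** X = 0}"
proof (intro equalityI subsetI CollectI)
  fix X assume "X \<in> {X. transpose X = X \<and> X ** Q + Q ** X = 0}"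
  then have X: "transpose X = X" "Q ** X = - (X ** Q)"
    by (auto simp: eq_neg_iff_add_eq_0 add.commute)
  note Qs = GrassmannianD[OF Q]
  define A where "A = (1/2) *\<^sub>R (X ** Q)"
  have A: "skew_symmetric A"
    by (simp add: A_def skew_symmetric_def transpose_scalar matrix_transpose_mul Qs X)
  have XQQ: "X ** Q ** Q = X"
    by (metis Qs(2) matrix_mul_assoc matrix_mul_rid)
  obtain E where E: "E 0 = mat 1" "\<And>t. orthogonal_matrix (E t)"
      "\<And>t. (E has_vector_derivative A ** E t) (at t)"
    using exists_orthogonal_flow[OF A] by blast
  \<comment> \<open>The commutator with \<open>A\<close>, which is the velocity field of conjugation
    by the flow \<open>E\<close>.\<close>
  define L where "L Y = A ** Y - Y ** A" for Y
  have L: "bounded_linear L"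
    unfolding linear_conv_bounded_linear[symmetric]
    by (intro linearI) (simp_all add: L_def matrix_mult_distribs scaleR_diff_right)
  define c where "c t = E t ** Q ** transpose (E t)" for t
  have c': "(c has_vector_derivative L (c t)) (at t)" for t
    unfolding c_def
  proof (rule has_vector_derivative_eq_rhs)
    show "((\<lambda>t. E t ** Q ** transpose (E t)) has_vector_derivative
        E t ** Q ** transpose (A ** E t) + (E t ** 0 + A ** E t ** Q) ** transpose (E t)) (at t)"
      by (intro bounded_bilinear.has_vector_derivative[OF bounded_bilinear_matrix_mult]
          bounded_linear.has_vector_derivative[OF bounded_linear_transpose] E(3)
          has_vector_derivative_const)
  qed (use A in \<open>simp add: L_def skew_symmetric_def matrix_transpose_mul matrix_mult_distribs
      matrix_mul_assoc\<close>)
  have "((\<lambda>t. (L ^^ m) (c t)) has_vector_derivative (L ^^ Suc m) (c t)) (at t)" for m t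
  proof (induction m)
    case (Suc m)
    from bounded_linear.has_vector_derivative[OF L this] show ?case by simp
  qed (simp add: c')
  then have smooth: "smooth_curve_on I c" for I
    unfolding smooth_curve_on_def by (intro exI[of _ "\<lambda>m t. (L ^^ m) (c t)"]) auto
  have c0: "c 0 = Q" by (simp add: c_def E(1))
  \<comment> \<open>By Q^2 = I and anticommutation, AQ = X/2 and QA = -X/2.\<close>
  have "A ** Q - Q ** A = X"
    by (simp add: A_def matrix_mult_distribs matrix_mul_assoc X(2) XQQ flip: scaleR_left_distrib)
  with c'[of 0] have "(c has_vector_derivative X) (at 0)"
    by (simp add: L_def c0)
  moreover have "range c \<subseteq> Grassmannian k"
    using Grassmannian_conjugate[OF Q E(2)] by (auto simp: c_def)
  ultimately show "X \<in> tangent_space (Grassmannian k) Q"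
    unfolding tangent_space_def using smooth c0
    \<comment> \<open>The curve is defined on the whole line, so any positive radius would
      do.\<close>
    by (intro CollectI exI[of _ "1::real"] exI[of _ c]) auto
qed (rule tangent_vector_equations)

section \<open>Tangential and normal parts, and the projections\<close>

lemma subspace_tangent_space_Grassmannian:
  assumes "Q \<in> Grassmannian k"
  shows "subspace (tangent_space (Grassmannian k) Q)"
  unfolding tangent_space_Grassmannian[OF assms]
proof (rule subspaceI)
  fix X Y :: "real^'a^'a" and r :: real
  assume X: "X \<in> {X. transpose X = X \<and> X ** Q + Q ** X = 0}"
  then show "r *\<^sub>R X \<in> {X. transpose X = X \<and> X ** Q + Q ** X = 0}"
    by (simp add: transpose_distribs matrix_mult_distribs flip: scaleR_right_distrib)
  assume "Y \<in> {X. transpose X = X \<and> X ** Q + Q ** X = 0}"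
  with X have "X ** Q + Q ** X + (Y ** Q + Q ** Y) = 0" "transpose X = X" "transpose Y = Y"
    by auto
  then show "X + Y \<in> {X. transpose X = X \<and> X ** Q + Q ** X = 0}"
    by (simp add: transpose_distribs matrix_mult_distribs add_ac)
qed (simp add: transpose_def vec_eq_iff)

text \<open>A linear image of the skew-symmetric matrices, cut down by homogeneous linear
  conditions.\<close>

lemma subspace_Grassmannian_normal_space: "subspace (Grassmannian_normal_space k Q)"
proof -
  have "orthogonal_tangent_space Q = (**) Q ` {\<Lambda>. skew_symmetric \<Lambda>}"
    by (auto simp: orthogonal_tangent_space_def)
  moreover have "subspace {\<Lambda> :: real^'a^'a. skew_symmetric \<Lambda>}"
    by (rule subspaceI)
      (auto simp: skew_symmetric_def transpose_distribs transpose_def[of 0] vec_eq_iff)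
  moreover have "linear ((**) Q)"
    by (intro linearI) (simp_all add: matrix_mult_distribs)
  ultimately have "subspace (orthogonal_tangent_space Q)"
    by (metis linear_subspace_image)
  then show ?thesis
    by (auto simp: subspace_def Grassmannian_normal_space_def trace_inner_eq_inner inner_add_left)
qed

text \<open>Transposition sends Q\<Lambda> to -\<Lambda>Q, which gives symmetry; with Q^2 = I, both
  products with Q reduce to Q\<Lambda>Q and \<Lambda> with opposite signs and cancel.\<close>

lemma tangential_part_in_tangent_space:
  assumes "Q \<in> Grassmannian k" "skew_symmetric \<Lambda>"
  shows "(1/2) *\<^sub>R (Q ** \<Lambda> - \<Lambda> ** Q) \<in> tangent_space (Grassmannian k) Q"
proof -
  note Qs = GrassmannianD[OF assms(1)]
  have "\<Lambda> ** Q ** Q = \<Lambda>"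
    by (metis Qs(2) matrix_mul_assoc matrix_mul_rid)
  then have "(1/2) *\<^sub>R (Q ** \<Lambda> - \<Lambda> ** Q) ** Q + Q ** ((1/2) *\<^sub>R (Q ** \<Lambda> - \<Lambda> ** Q)) = 0"
    by (simp add: matrix_mult_distribs matrix_mul_assoc Qs flip: scaleR_right_distrib)
  then show ?thesis
    using assms(2) unfolding tangent_space_Grassmannian[OF assms(1)]
    by (simp add: transpose_distribs matrix_transpose_mul Qs skew_symmetric_def
        matrix_mult_distribs)
qed

lemma normal_part_in_normal_space:
  assumes "Q \<in> Grassmannian k" "skew_symmetric \<Lambda>"
  shows "(1/2) *\<^sub>R (Q ** \<Lambda> + \<Lambda> ** Q) \<in> Grassmannian_normal_space k Q"
proof -
  note Qs = GrassmannianD[OF assms(1)]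
  have \<Lambda>: "transpose \<Lambda> = - \<Lambda>" using assms(2) by (simp add: skew_symmetric_def)
  \<comment> \<open>Obtained by multiplying the normal part on the left by Q, its own inverse.
    Skewness of \<open>?M\<close> puts the normal part in the tangent space of O(n); skewness of the
    normal part itself gives orthogonality.\<close>
  let ?M = "(1/2) *\<^sub>R (\<Lambda> + Q ** \<Lambda> ** Q)"
  have "skew_symmetric ?M"
    by (simp add: skew_symmetric_def transpose_distribs matrix_transpose_mul Qs \<Lambda>
        matrix_mult_distribs matrix_mul_assoc flip: scaleR_minus_right)
  moreover have "(1/2) *\<^sub>R (Q ** \<Lambda> + \<Lambda> ** Q) = Q ** ?M"
    by (simp add: matrix_mult_distribs matrix_mul_assoc Qs)
  ultimately have "(1/2) *\<^sub>R (Q ** \<Lambda> + \<Lambda> ** Q) \<in> orthogonal_tangent_space Q"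
    unfolding orthogonal_tangent_space_def by blast
  moreover have "skew_symmetric ((1/2) *\<^sub>R (Q ** \<Lambda> + \<Lambda> ** Q))"
    by (simp add: skew_symmetric_def transpose_distribs matrix_transpose_mul Qs \<Lambda>
        matrix_mult_distribs flip: scaleR_minus_right)
  ultimately show ?thesis
    unfolding Grassmannian_normal_space_def tangent_space_Grassmannian[OF assms(1)]
      trace_inner_eq_inner
    using inner_skew_symmetric_symmetric by blast
qed

theorem corollary3p7:
  fixes Q V \<Lambda> :: "real^('n::{finite,linorder})^('n::{finite,linorder})" and k :: nat
  assumes "1 \<le> k" and "k \<le> CARD('n)"
    and "Q \<in> Grassmannian k"
    and "orthogonal_matrix V"
    and "Q = V ** signature_matrix k ** transpose V"
    and "skew_symmetric \<Lambda>"
  shows "proj_tangent k Q (Q ** \<Lambda>) = (1/2) *\<^sub>R (Q ** \<Lambda> - \<Lambda> ** Q)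
       \<and> proj_normal k Q (Q ** \<Lambda>) = (1/2) *\<^sub>R (Q ** \<Lambda> + \<Lambda> ** Q)
       \<and> (\<forall>S. Q ** \<Lambda> = V ** S ** transpose V \<and> skew_symmetric (signature_matrix k ** S) \<longrightarrow>
            proj_tangent k Q (Q ** \<Lambda>) = (1/2) *\<^sub>R (V ** (S + transpose S) ** transpose V) \<and>
            proj_normal k Q (Q ** \<Lambda>) = (1/2) *\<^sub>R (V ** (S - transpose S) ** transpose V))"
proof -
  note Q = \<open>Q \<in> Grassmannian k\<close> and skew = \<open>skew_symmetric \<Lambda>\<close>
  let ?T = "(1/2) *\<^sub>R (Q ** \<Lambda> - \<Lambda> ** Q)" and ?N = "(1/2) *\<^sub>R (Q ** \<Lambda> + \<Lambda> ** Q)"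
  note T = tangential_part_in_tangent_space[OF Q skew]
  note N = normal_part_in_normal_space[OF Q skew]
  have sum: "Q ** \<Lambda> = ?T + ?N"
    by (simp add: algebra_simps flip: scaleR_left_distrib)
  \<comment> \<open>With \<open>sum\<close>, this makes each part the residual of the other
    projection, orthogonal to its target space.\<close>
  have orth: "Y \<bullet> Z = 0"
    if "Y \<in> Grassmannian_normal_space k Q" "Z \<in> tangent_space (Grassmannian k) Q" for Y Z
    using that by (simp add: Grassmannian_normal_space_def trace_inner_eq_inner)
  have projT: "proj_tangent k Q (Q ** \<Lambda>) = ?T"
    unfolding proj_tangent_def
  proof (rule orth_proj_eqI[OF subspace_tangent_space_Grassmannian[OF Q] T])
    have "Q ** \<Lambda> - ?T = ?N" by (subst sum) simp
    then show "trace_inner (Q ** \<Lambda> - ?T) Z = 0" if "Z \<in> tangent_space (Grassmannian k) Q" for Z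
      using orth[OF N that] by (simp add: trace_inner_eq_inner)
  qed
  have projN: "proj_normal k Q (Q ** \<Lambda>) = ?N"
    unfolding proj_normal_def
  proof (rule orth_proj_eqI[OF subspace_Grassmannian_normal_space N])
    have "Q ** \<Lambda> - ?N = ?T" by (subst sum) simp
    then show "trace_inner (Q ** \<Lambda> - ?N) Z = 0" if "Z \<in> Grassmannian_normal_space k Q" for Z
      using orth[OF that T] by (simp add: trace_inner_eq_inner inner_commute)
  qed
  have "?T = (1/2) *\<^sub>R (V ** (S + transpose S) ** transpose V) \<and>
      ?N = (1/2) *\<^sub>R (V ** (S - transpose S) ** transpose V)"
    if S: "Q ** \<Lambda> = V ** S ** transpose V" for S
  proof -
    \<comment> \<open>Transposing the decomposition expresses \<Lambda>Q through the transpose of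
      \<open>S\<close>; the sign change turns the difference in \<open>?T\<close> into a sum and the
      sum in \<open>?N\<close> into a difference.\<close>
    have "- (\<Lambda> ** Q) = transpose (Q ** \<Lambda>)"
      using skew by (simp add: skew_symmetric_def matrix_transpose_mul GrassmannianD[OF Q]
          matrix_mult_distribs)
    also have "\<dots> = V ** transpose S ** transpose V"
      by (simp add: S matrix_transpose_mul matrix_mul_assoc)
    finally have "\<Lambda> ** Q = - (V ** transpose S ** transpose V)"
      by (metis minus_minus)
    then show ?thesis
      by (simp add: S matrix_mult_distribs)
  qed
  with projT projN show ?thesis by auto
qed

end
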